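(* Let $F:\mathbb{N}\to\mathbb{N}$ be a fixed total recursive function. The set $$SI(F)=\{x\in\mathbb{N}\mid \forall z,\ \varphi_x(z)\downarrow\implies \varphi_x(z)\leq F(z)\}$$ (the sup-interpretation verification problem for $F$) is $\Pi^0_1$-complete in the arithmetical hierarchy.
   Context: Fix an acceptable Gödel numbering of the partial recursive functions: $\varphi_x$ denotes the partial recursive function $\mathbb{N}\to\mathbb{N}$ with Gödel number $x$; $\varphi_x(z)\downarrow$ means $\varphi_x$ is defined on $z$. A sup-interpretation of a partial recursive function $f$ is a total recursive function $F$ with $F(z)\geq f(z)$ whenever $f(z)$ is defined; thus $x\in SI(F)$ says that $F$ is a sup-interpretation of $\varphi_x$. *)

theory Defs
  imports Main
begin

section \<open>Partial recursive functions\<close>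

(* A k-ary partial function is a map from lists to options, of which only the values on
   lists of length k are meaningful; see the rule ext below. *)

definition compose :: "(nat list \<rightharpoonup> nat) \<Rightarrow> (nat list \<rightharpoonup> nat) list \<Rightarrow> (nat list \<rightharpoonup> nat)" where
  "compose f gs = (\<lambda>xs. Option.bind (those (map (\<lambda>g. g xs) gs)) f)"

primrec prim_rec :: "(nat list \<rightharpoonup> nat) \<Rightarrow> (nat list \<rightharpoonup> nat) \<Rightarrow> nat \<Rightarrow> (nat list \<rightharpoonup> nat)" where
  "prim_rec f g 0 = f"
| "prim_rec f g (Suc n) = (\<lambda>xs. Option.bind (prim_rec f g n xs) (\<lambda>r. g (n # r # xs)))"

(* Unbounded search: f must converge at every argument below the result. *)
definition minimise :: "(nat list \<rightharpoonup> nat) \<Rightarrow> (nat list \<rightharpoonup> nat)" where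
  "minimise f = (\<lambda>xs.
     if \<exists>y. f (y # xs) = Some 0 \<and> (\<forall>i<y. f (i # xs) \<noteq> None)
     then Some (LEAST y. f (y # xs) = Some 0) else None)"

inductive partial_recursive :: "nat \<Rightarrow> (nat list \<rightharpoonup> nat) \<Rightarrow> bool" where
  zero: "partial_recursive k (\<lambda>xs. Some 0)"
| succ: "partial_recursive 1 (\<lambda>xs. Some (Suc (hd xs)))"
| proj: "i < k \<Longrightarrow> partial_recursive k (\<lambda>xs. Some (xs ! i))"
| comp: "partial_recursive (length gs) f \<Longrightarrow> \<forall>g\<in>set gs. partial_recursive k g \<Longrightarrow>
    partial_recursive k (compose f gs)"
| prec: "partial_recursive k f \<Longrightarrow> partial_recursive (Suc (Suc k)) g \<Longrightarrow>
    partial_recursive (Suc k) (\<lambda>xs. prim_rec f g (hd xs) (tl xs))"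
| mini: "partial_recursive (Suc k) f \<Longrightarrow> partial_recursive k (minimise f)"
| ext: "partial_recursive k f \<Longrightarrow> (\<And>xs. length xs = k \<Longrightarrow> f xs = f' xs) \<Longrightarrow>
    partial_recursive k f'"

definition total_recursive :: "(nat \<Rightarrow> nat) \<Rightarrow> bool" where
  "total_recursive F \<longleftrightarrow> partial_recursive 1 (\<lambda>xs. Some (F (hd xs)))"

definition decidable_rel :: "nat \<Rightarrow> (nat list \<Rightarrow> bool) \<Rightarrow> bool" where
  "decidable_rel k R \<longleftrightarrow> partial_recursive k (\<lambda>xs. Some (of_bool (R xs)))"


section \<open>Acceptable numberings\<close>

(* The first conjunct is the enumeration (universal function) property, the second is the
   parametrisation (s-m-n) property. For unary f, the instance psi [x, z] = f [z] of the
   second one shows that every unary partial recursive function has an index; see the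
   lemma below. *)
definition acceptable_numbering :: "(nat \<Rightarrow> (nat \<rightharpoonup> nat)) \<Rightarrow> bool" where
  "acceptable_numbering \<phi> \<longleftrightarrow>
     partial_recursive 2 (\<lambda>xs. \<phi> (xs ! 0) (xs ! 1)) \<and>
     (\<forall>\<psi>. partial_recursive 2 \<psi> \<longrightarrow>
        (\<exists>s. total_recursive s \<and> (\<forall>x z. \<phi> (s x) z = \<psi> [x, z])))"

lemma acceptable_numbering_surj:
  assumes "acceptable_numbering \<phi>" and "partial_recursive 1 f"
  shows "\<exists>e. \<forall>z. \<phi> e z = f [z]"
proof -
  have "partial_recursive 2 (compose f [\<lambda>xs. Some (xs ! 1)])"
    using assms(2) by (intro comp) (auto intro: proj)
  then obtain s where "\<forall>x z. \<phi> (s x) z = compose f [\<lambda>xs. Some (xs ! 1)] [x, z]"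
    using assms(1) unfolding acceptable_numbering_def by blast
  then show ?thesis by (auto simp: compose_def)
qed


section \<open>The arithmetical hierarchy\<close>

fun sigma_rel :: "nat \<Rightarrow> nat \<Rightarrow> (nat list \<Rightarrow> bool) \<Rightarrow> bool"
  and pi_rel :: "nat \<Rightarrow> nat \<Rightarrow> (nat list \<Rightarrow> bool) \<Rightarrow> bool" where
  "sigma_rel 0 k R = decidable_rel k R"
| "sigma_rel (Suc n) k R =
     (\<exists>Q. pi_rel n (Suc k) Q \<and> (\<forall>xs. length xs = k \<longrightarrow> R xs = (\<exists>y. Q (y # xs))))"
| "pi_rel 0 k R = decidable_rel k R"
| "pi_rel (Suc n) k R =
     (\<exists>Q. sigma_rel n (Suc k) Q \<and> (\<forall>xs. length xs = k \<longrightarrow> R xs = (\<forall>y. Q (y # xs))))"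

definition pi_set :: "nat \<Rightarrow> nat set \<Rightarrow> bool" where
  "pi_set n A \<longleftrightarrow> pi_rel n 1 (\<lambda>xs. hd xs \<in> A)"

definition many_one_reducible :: "nat set \<Rightarrow> nat set \<Rightarrow> bool" where
  "many_one_reducible B A \<longleftrightarrow> (\<exists>h. total_recursive h \<and> (\<forall>x. x \<in> B \<longleftrightarrow> h x \<in> A))"

definition pi_complete :: "nat \<Rightarrow> nat set \<Rightarrow> bool" where
  "pi_complete n A \<longleftrightarrow> pi_set n A \<and> (\<forall>B. pi_set n B \<longrightarrow> many_one_reducible B A)"


section \<open>Sup-interpretations\<close>

definition SI :: "(nat \<Rightarrow> (nat \<rightharpoonup> nat)) \<Rightarrow> (nat \<Rightarrow> nat) \<Rightarrow> nat set" where
  "SI \<phi> F = {x. \<forall>z. z \<in> dom (\<phi> x) \<longrightarrow> the (\<phi> x z) \<le> F z}"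

end

theory Submission
  imports Defs
begin

text \<open>Every partial recursive function is the limit of uniformly total recursive stages, where
  stage \<open>t\<close> bounds every unbounded search by \<open>t\<close>; the stages never produce a wrong value
  and eventually produce every value. Hence \<open>x\<close> lies in \<open>SI \<phi> F\<close> iff for all \<open>y\<close> no stage-\<open>y\<close>
  value of \<open>\<phi> x z\<close> with \<open>z \<le> y\<close> exceeds \<open>F z\<close>, a single universal quantifier over a decidable
  relation. For hardness, a set \<open>{x. \<forall>y. Q y x}\<close> with \<open>Q\<close> decidable is reduced by sending \<open>x\<close> to
  an index of the function that on input \<open>z\<close> searches for a counterexample to \<open>Q\<close> and then returns
  \<open>F z + 1\<close>.\<close>

section \<open>Total recursive functions of several arguments\<close>

definition recursive_fn :: "nat \<Rightarrow> (nat list \<Rightarrow> nat) \<Rightarrow> bool" where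
  "recursive_fn k f \<longleftrightarrow> partial_recursive k (\<lambda>xs. Some (f xs))"

lemma recursive_fn_cong:
  assumes "recursive_fn k f" "\<And>xs. length xs = k \<Longrightarrow> f xs = g xs"
  shows "recursive_fn k g"
  using assms unfolding recursive_fn_def by (auto intro: ext)

lemma those_map_Some: "those (map (\<lambda>g. Some (f g)) gs) = Some (map f gs)"
  by (induction gs) auto

lemma recursive_fn_comp:
  assumes "recursive_fn (length gs) f" "\<forall>g\<in>set gs. recursive_fn k g"
  shows "recursive_fn k (\<lambda>xs. f (map (\<lambda>g. g xs) gs))"
proof -
  have "partial_recursive k (compose (\<lambda>xs. Some (f xs)) (map (\<lambda>g xs. Some (g xs)) gs))"
    using assms unfolding recursive_fn_def by (intro comp) auto
  then show ?thesis
    unfolding recursive_fn_def by (simp add: compose_def comp_def those_map_Some)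
qed

lemma recursive_fn_nth: "i < k \<Longrightarrow> recursive_fn k (\<lambda>xs. xs ! i)"
  unfolding recursive_fn_def by (rule proj)

lemma recursive_fn_hd: "recursive_fn (Suc k) hd"
  using recursive_fn_nth[of 0 "Suc k"] by (rule recursive_fn_cong) (auto simp: length_Suc_conv)

lemma recursive_fn_unary:
  assumes "recursive_fn 1 (\<lambda>xs. F (hd xs))" "recursive_fn k a"
  shows "recursive_fn k (\<lambda>xs. F (a xs))"
  using recursive_fn_comp[of "[a]" "\<lambda>xs. F (hd xs)" k] assms by simp

lemma recursive_fn_Suc: "recursive_fn k a \<Longrightarrow> recursive_fn k (\<lambda>xs. Suc (a xs))"
  using recursive_fn_unary[of Suc] succ by (simp add: recursive_fn_def)

lemma recursive_fn_const: "recursive_fn k (\<lambda>xs. c)"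
proof (induction c)
  case 0
  show ?case unfolding recursive_fn_def by (rule zero)
next
  case (Suc c)
  then show ?case by (rule recursive_fn_Suc)
qed

text \<open>Substitution for lists of unspecified length: the functions in \<open>gs\<close> compute
  the leading arguments and the rest of the input is passed on unchanged. The tail
  \<open>drop j xs\<close> is itself a list of projections, so this is ordinary composition.\<close>

lemma recursive_fn_append_drop:
  assumes "recursive_fn (length gs + k) f" "\<forall>g\<in>set gs. recursive_fn m g" "m = j + k"
  shows "recursive_fn m (\<lambda>xs. f (map (\<lambda>g. g xs) gs @ drop j xs))"
proof -
  have "recursive_fn m (\<lambda>xs. f (map (\<lambda>g. g xs) (gs @ map (\<lambda>i xs. xs ! i) [j..<m])))"
    using assms by (intro recursive_fn_comp) (auto intro: recursive_fn_nth)
  moreover have "map (\<lambda>i. xs ! i) [j..<m] = drop j xs" if "length xs = m" for xs :: "nat list"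
    using that assms(3) by (intro nth_equalityI) auto
  ultimately show ?thesis
    by (elim recursive_fn_cong) (simp add: comp_def)
qed

lemma recursive_fn_drop:
  assumes "recursive_fn k f" "m = j + k"
  shows "recursive_fn m (\<lambda>xs. f (drop j xs))"
  using recursive_fn_append_drop[of "[]" k f m j] assms by simp

section \<open>Primitive recursion, branching and bounded quantification\<close>

lemma prim_rec_Some:
  "prim_rec (\<lambda>xs. Some (f xs)) (\<lambda>ys. Some (g ys)) n xs = Some (rec_nat (f xs) (\<lambda>n r. g (n # r # xs)) n)"
  by (induction n) auto

text \<open>The recursion scheme takes the counter from the head of the list; substituting
  \<open>a\<close> in front of the untouched input lets the depth depend on the parameters.\<close>

lemma recursive_fn_rec_nat:
  assumes f: "recursive_fn k f"
    and g: "recursive_fn (Suc (Suc k)) (\<lambda>ys. g (ys ! 0) (ys ! 1) (drop 2 ys))"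
    and a: "recursive_fn k a"
  shows "recursive_fn k (\<lambda>xs. rec_nat (f xs) (\<lambda>n r. g n r xs) (a xs))"
proof -
  have "recursive_fn (Suc k) (\<lambda>xs. rec_nat (f (tl xs)) (\<lambda>n r. g n r (tl xs)) (hd xs))"
    using prec[OF f[unfolded recursive_fn_def] g[unfolded recursive_fn_def]]
    unfolding recursive_fn_def by (simp add: prim_rec_Some)
  from recursive_fn_append_drop[of "[a]" k _ k 0, simplified, OF this a]
  show ?thesis by simp
qed

lemma recursive_fn_if_zero:
  assumes "recursive_fn k a" "recursive_fn k b" "recursive_fn k c"
  shows "recursive_fn k (\<lambda>xs. if a xs = 0 then b xs else c xs)"
proof -
  have "recursive_fn k (\<lambda>xs. rec_nat (b xs) (\<lambda>n r. c xs) (a xs))"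
    using assms by (intro recursive_fn_rec_nat recursive_fn_drop) auto
  moreover have "rec_nat u (\<lambda>n r. w) m = (if m = 0 then u else w)" for u w m :: nat
    by (cases m) auto
  ultimately show ?thesis by simp
qed

lemma recursive_fn_pred:
  assumes "recursive_fn k a"
  shows "recursive_fn k (\<lambda>xs. a xs - 1)"
proof -
  have "recursive_fn k (\<lambda>xs. rec_nat 0 (\<lambda>n r. n) (a xs))"
    using assms by (intro recursive_fn_rec_nat recursive_fn_const recursive_fn_nth) auto
  moreover have "rec_nat 0 (\<lambda>n r. n) m = m - 1" for m :: nat
    by (cases m) auto
  ultimately show ?thesis by simp
qed

lemma recursive_fn_diff:
  assumes "recursive_fn k a" "recursive_fn k b"
  shows "recursive_fn k (\<lambda>xs. a xs - b xs)"
proof -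
  have "recursive_fn k (\<lambda>xs. rec_nat (a xs) (\<lambda>n r. r - 1) (b xs))"
    using assms by (intro recursive_fn_rec_nat recursive_fn_pred recursive_fn_nth) auto
  moreover have "rec_nat m (\<lambda>n r. r - 1) n = m - n" for m n :: nat
    by (induction n) auto
  ultimately show ?thesis by simp
qed

lemma recursive_fn_if_all_nonzero:
  assumes "recursive_fn k h" "\<forall>g\<in>set gs. recursive_fn k g"
  shows "recursive_fn k (\<lambda>xs. if \<forall>g\<in>set gs. g xs \<noteq> 0 then h xs else 0)"
  using assms(2)
proof (induction gs)
  case Nil
  then show ?case using assms(1) by simp
next
  case (Cons g gs)
  then have "recursive_fn k (\<lambda>xs. if g xs = 0 then 0 else
      if \<forall>g\<in>set gs. g xs \<noteq> 0 then h xs else 0)"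
    by (intro recursive_fn_if_zero recursive_fn_const) auto
  then show ?case by (rule recursive_fn_cong) auto
qed

text \<open>A recursion along \<open>z\<close> starts with the flag 1, replaces it by the truth
  value of \<open>P z xs\<close> while it is nonzero, and keeps 0 once a counterexample has
  occurred.\<close>

lemma recursive_fn_ball_less:
  assumes P: "recursive_fn (Suc k) (\<lambda>ys. of_bool (P (hd ys) (tl ys)))" and a: "recursive_fn k a"
  shows "recursive_fn k (\<lambda>xs. of_bool (\<forall>z < a xs. P z xs))"
proof -
  let ?Q = "\<lambda>ys. of_bool (P (hd ys) (tl ys)) :: nat"
  have "recursive_fn (Suc (Suc k)) (\<lambda>ys. ?Q (map (\<lambda>g. g ys) [\<lambda>ys. ys ! 0] @ drop 2 ys))"
    using P by (intro recursive_fn_append_drop[where k = k and f = ?Q]) (auto intro: recursive_fn_nth)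
  then have "recursive_fn (Suc (Suc k)) (\<lambda>ys. of_bool (P (ys ! 0) (drop 2 ys)))"
    by simp
  then have "recursive_fn k (\<lambda>xs. rec_nat 1 (\<lambda>z r. if r = 0 then 0 else of_bool (P z xs)) (a xs))"
    using a by (intro recursive_fn_rec_nat recursive_fn_if_zero recursive_fn_const recursive_fn_nth) auto
  moreover have "rec_nat 1 (\<lambda>z r. if r = 0 then 0 else of_bool (P z xs)) n
      = (of_bool (\<forall>z<n. P z xs) :: nat)" for n xs
    by (induction n) (auto simp: less_Suc_eq)
  ultimately show ?thesis by simp
qed


section \<open>Stages of partial recursive functions\<close>

text \<open>With 0 standing for divergence, a stage becomes a total number-valued function, to which
  the closure properties of \<open>recursive_fn\<close> apply.\<close>

definition encode_option :: "nat option \<Rightarrow> nat" where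
  "encode_option u = (case u of None \<Rightarrow> 0 | Some v \<Rightarrow> Suc v)"

lemma encode_option_simps [simp]:
  "encode_option None = 0" "encode_option (Some v) = Suc v"
  "encode_option u = 0 \<longleftrightarrow> u = None" "encode_option u = Suc v \<longleftrightarrow> u = Some v"
  by (auto simp: encode_option_def split: option.splits)

text \<open>Values must be right at every stage but need only appear eventually. Asking for all
  large \<open>t\<close>, and not just for some \<open>t\<close>, lets finitely many computations be
  completed at a common stage.\<close>

definition stages :: "nat \<Rightarrow> (nat \<Rightarrow> nat list \<rightharpoonup> nat) \<Rightarrow> (nat list \<rightharpoonup> nat) \<Rightarrow> bool" where
  "stages k s f \<longleftrightarrow> recursive_fn (Suc k) (\<lambda>ys. encode_option (s (hd ys) (tl ys))) \<and>
     (\<forall>xs v. length xs = k \<longrightarrow>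
        (\<forall>t. s t xs = Some v \<longrightarrow> f xs = Some v) \<and>
        (f xs = Some v \<longrightarrow> (\<forall>\<^sub>F t in sequentially. s t xs = Some v)))"

lemma stages_sound:
  "stages k s f \<Longrightarrow> length xs = k \<Longrightarrow> s t xs = Some v \<Longrightarrow> f xs = Some v"
  unfolding stages_def by blast

lemma stages_complete:
  "stages k s f \<Longrightarrow> length xs = k \<Longrightarrow> f xs = Some v \<Longrightarrow> \<forall>\<^sub>F t in sequentially. s t xs = Some v"
  unfolding stages_def by blast

lemma stages_recursive_fn:
  assumes "stages (length gs + k) s f" "recursive_fn m a" "\<forall>g\<in>set gs. recursive_fn m g" "m = j + k"
  shows "recursive_fn m (\<lambda>xs. encode_option (s (a xs) (map (\<lambda>g. g xs) gs @ drop j xs)))"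
  using recursive_fn_append_drop[of "a # gs" k _ m j] assms
  unfolding stages_def by fastforce

lemma stages_of_total:
  assumes "recursive_fn k f"
  shows "stages k (\<lambda>t xs. Some (f xs)) (\<lambda>xs. Some (f xs))"
  using recursive_fn_Suc[OF recursive_fn_drop[OF assms, of "Suc k" 1]]
  by (simp add: stages_def drop_Suc)

section \<open>Stages of compositions\<close>

lemma those_eq_Some_iff: "those us = Some vs \<longleftrightarrow> us = map Some vs"
  by (induction us arbitrary: vs) (auto split: option.splits simp: Cons_eq_map_conv)

lemma compose_eq_Some_iff:
  "compose f gs xs = Some v \<longleftrightarrow> (\<exists>ws. map (\<lambda>g. g xs) gs = map Some ws \<and> f ws = Some v)"
  by (auto simp: compose_def bind_eq_Some_conv those_eq_Some_iff)

lemma encode_option_compose: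
  "encode_option (compose f gs xs) = (if \<forall>g\<in>set gs. encode_option (g xs) \<noteq> 0
     then encode_option (f (map (\<lambda>g. encode_option (g xs) - 1) gs)) else 0)"
proof (cases "those (map (\<lambda>g. g xs) gs)")
  case None
  then have "\<exists>g\<in>set gs. g xs = None"
    by (induction gs) (auto split: option.splits)
  with None show ?thesis by (auto simp: compose_def)
next
  case (Some ws)
  then have eq: "map (\<lambda>g. g xs) gs = map Some ws" by (simp add: those_eq_Some_iff)
  then have "map (\<lambda>u. encode_option u - 1) (map (\<lambda>g. g xs) gs) = ws" by (simp add: comp_def)
  then have "map (\<lambda>g. encode_option (g xs) - 1) gs = ws" by (simp add: comp_def)
  moreover have "\<forall>g\<in>set gs. g xs \<noteq> None"
    using arg_cong[OF eq, of set] by auto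
  ultimately show ?thesis using Some by (simp add: compose_def)
qed

text \<open>All functions run with the same stage number. Correctness passes through componentwise,
  and since \<open>gs\<close> is finite, from some stage on all inner values are present together
  with the outer one.\<close>

lemma stages_compose:
  assumes f: "stages (length gs) s f" and g: "\<forall>g\<in>set gs. stages k (S g) g"
  shows "stages k (\<lambda>t. compose (s t) (map (\<lambda>g. S g t) gs)) (compose f gs)"
  unfolding stages_def
proof (intro conjI allI impI)
  let ?e = "\<lambda>g ys. encode_option (S g (hd ys) (tl ys))"
  have e: "recursive_fn (Suc k) (?e g)" if "g \<in> set gs" for g
    using g that unfolding stages_def by blast
  \<comment> \<open>The list \<open>drop (Suc k) ys\<close> is empty and only fits the term to
    \<open>stages_recursive_fn\<close>. The subtraction of 1 decodes the inner values, which matters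
    only when none of the codes is 0.\<close>
  have "recursive_fn (Suc k) (\<lambda>ys. encode_option
      (s (hd ys) (map (\<lambda>g. g ys) (map (\<lambda>g ys. ?e g ys - 1) gs) @ drop (Suc k) ys)))"
    using f e recursive_fn_hd by (intro stages_recursive_fn[where k = 0]) (auto intro: recursive_fn_pred[unfolded One_nat_def])
  then have "recursive_fn (Suc k) (\<lambda>ys. encode_option (s (hd ys) (map (\<lambda>g. ?e g ys - 1) gs)))"
    by (rule recursive_fn_cong) (simp add: comp_def)
  from recursive_fn_if_all_nonzero[OF this, of "map ?e gs"] e
  have "recursive_fn (Suc k) (\<lambda>ys. if \<forall>g\<in>set gs. ?e g ys \<noteq> 0
      then encode_option (s (hd ys) (map (\<lambda>g. ?e g ys - 1) gs)) else 0)"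
    by (simp del: encode_option_simps)
  then show "recursive_fn (Suc k) (\<lambda>ys. encode_option
      (compose (s (hd ys)) (map (\<lambda>g. S g (hd ys)) gs) (tl ys)))"
    by (rule recursive_fn_cong) (auto simp add: encode_option_compose comp_def simp del: encode_option_simps)
next
  fix xs :: "nat list" and v t
  assume xs: "length xs = k" and "compose (s t) (map (\<lambda>g. S g t) gs) xs = Some v"
  then obtain ws where ws: "map (\<lambda>g. S g t xs) gs = map Some ws" "s t ws = Some v"
    by (auto simp: compose_eq_Some_iff comp_def)
  have len: "length ws = length gs"
    using arg_cong[OF ws(1), of length] by simp
  have "map (\<lambda>g. g xs) gs = map Some ws"
  proof (intro nth_equalityI)
    fix i assume "i < length (map (\<lambda>g. g xs) gs)"
    then have i: "i < length gs" by simp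
    with arg_cong[OF ws(1), of "\<lambda>us. us ! i"] len have "S (gs ! i) t xs = Some (ws ! i)" by simp
    then have "(gs ! i) xs = Some (ws ! i)"
      using stages_sound[of k "S (gs ! i)" "gs ! i"] g xs nth_mem[OF i] by blast
    with i len show "map (\<lambda>g. g xs) gs ! i = map Some ws ! i" by simp
  qed (simp add: len)
  moreover have "f ws = Some v" using stages_sound[OF f len ws(2)] .
  ultimately show "compose f gs xs = Some v" by (auto simp: compose_eq_Some_iff)
next
  fix xs :: "nat list" and v
  assume xs: "length xs = k" and "compose f gs xs = Some v"
  then obtain ws where ws: "map (\<lambda>g. g xs) gs = map Some ws" "f ws = Some v"
    by (auto simp: compose_eq_Some_iff comp_def)
  have len: "length ws = length gs"
    using arg_cong[OF ws(1), of length] by simp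
  have "\<forall>\<^sub>F t in sequentially. \<forall>g\<in>set gs. S g t xs = g xs"
  proof (intro eventually_ball_finite ballI)
    fix h assume h: "h \<in> set gs"
    then have "h xs \<in> set (map Some ws)" using ws(1) by (metis (mono_tags) image_eqI list.set_map)
    then obtain w where "h xs = Some w" by auto
    with stages_complete g h xs show "\<forall>\<^sub>F t in sequentially. S h t xs = h xs" by metis
  qed simp
  then show "\<forall>\<^sub>F t in sequentially. compose (s t) (map (\<lambda>g. S g t) gs) xs = Some v"
    using stages_complete[OF f len ws(2)]
  proof eventually_elim
    case (elim t)
    then have "map (\<lambda>g. S g t xs) gs = map Some ws" using ws(1) by (metis (mono_tags, lifting) map_cong)
    with elim show ?case by (auto simp: compose_eq_Some_iff comp_def)
  qed
qed

section \<open>Stages of primitive recursions\<close>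

lemma encode_option_prim_rec:
  "encode_option (prim_rec f g n xs) = rec_nat (encode_option (f xs))
     (\<lambda>n r. if r = 0 then 0 else encode_option (g (n # (r - 1) # xs))) n"
proof (induction n)
  case (Suc n)
  then show ?case by (cases "prim_rec f g n xs") (simp_all add: Suc[symmetric])
qed simp

text \<open>Stage \<open>t\<close> truncates only \<open>f\<close> and \<open>g\<close>, not the
  depth of the recursion. For a fixed depth finitely many values of \<open>f\<close> and
  \<open>g\<close> are involved, so induction on the depth gives both correctness and eventual
  convergence.\<close>

lemma stages_prim_rec:
  assumes f: "stages k s f" and g: "stages (Suc (Suc k)) s' g"
  shows "stages (Suc k) (\<lambda>t xs. prim_rec (s t) (s' t) (hd xs) (tl xs))
    (\<lambda>xs. prim_rec f g (hd xs) (tl xs))"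
  unfolding stages_def
proof (intro conjI allI impI)
  let ?m = "Suc (Suc k)"
  have "recursive_fn ?m (\<lambda>ys. encode_option (s (ys ! 0) (map (\<lambda>g. g ys) [] @ drop 2 ys)))"
    using f by (intro stages_recursive_fn[where k = k and f = f]) (auto intro: recursive_fn_nth)
  then have "recursive_fn ?m (\<lambda>ys. encode_option (s (ys ! 0) (drop 2 ys)))"
    by simp
  \<comment> \<open>The entries of \<open>zs\<close> are the counter, the coded previous value, the
    stage, the recursion depth and then the \<open>k\<close> parameters. Hence the stage is
    \<open>zs ! 2\<close>, the parameters are \<open>drop 4 zs\<close>, and
    \<open>zs ! 1 - 1\<close> decodes the previous value.\<close>
  moreover have "recursive_fn (Suc (Suc ?m)) (\<lambda>zs. encode_option (s' (zs ! 2)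
      (map (\<lambda>g. g zs) [\<lambda>zs. zs ! 0, \<lambda>zs. zs ! 1 - 1] @ drop 4 zs)))"
  proof (rule stages_recursive_fn[where k = k])
    show "\<forall>a\<in>set [\<lambda>zs. zs ! 0, \<lambda>zs. zs ! 1 - 1]. recursive_fn (Suc (Suc ?m)) a"
      using recursive_fn_nth[of 0 "Suc (Suc ?m)"] recursive_fn_pred[OF recursive_fn_nth[of 1 "Suc (Suc ?m)"]]
      by simp
  qed (use g in \<open>auto intro: recursive_fn_nth\<close>)
  then have "recursive_fn (Suc (Suc ?m)) (\<lambda>zs. encode_option (s' (drop 2 zs ! 0)
      (zs ! 0 # (zs ! 1 - 1) # drop 2 (drop 2 zs))))"
    by (rule recursive_fn_cong) (simp add: numeral_eq_Suc)
  ultimately have "recursive_fn ?m (\<lambda>ys. rec_nat (encode_option (s (ys ! 0) (drop 2 ys)))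
     (\<lambda>n r. if r = 0 then 0 else encode_option (s' (ys ! 0) (n # (r - 1) # drop 2 ys))) (ys ! 1))"
    by (intro recursive_fn_rec_nat recursive_fn_if_zero recursive_fn_const)
      (auto intro!: recursive_fn_nth)
  then have "recursive_fn ?m (\<lambda>ys. encode_option
      (prim_rec (s (ys ! 0)) (s' (ys ! 0)) (ys ! 1) (drop 2 ys)))"
    by (simp only: encode_option_prim_rec)
  then show "recursive_fn ?m (\<lambda>ys. encode_option
      (prim_rec (s (hd ys)) (s' (hd ys)) (hd (tl ys)) (tl (tl ys))))"
    by (rule recursive_fn_cong) (auto simp: length_Suc_conv numeral_eq_Suc)
next
  fix xs :: "nat list" and v t
  assume len: "length xs = Suc k" and "prim_rec (s t) (s' t) (hd xs) (tl xs) = Some v"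
  moreover have "prim_rec (s t) (s' t) n (tl xs) = Some v \<Longrightarrow> prim_rec f g n (tl xs) = Some v" for n
  proof (induction n arbitrary: v)
    case 0
    with stages_sound[OF f, of "tl xs"] len show ?case by simp
  next
    case (Suc n)
    then obtain r where "prim_rec (s t) (s' t) n (tl xs) = Some r" "s' t (n # r # tl xs) = Some v"
      by (auto simp: bind_eq_Some_conv)
    with Suc.IH stages_sound[OF g, of "n # r # tl xs"] len show ?case by simp
  qed
  ultimately show "prim_rec f g (hd xs) (tl xs) = Some v" by blast
next
  fix xs :: "nat list" and v
  assume len: "length xs = Suc k" and "prim_rec f g (hd xs) (tl xs) = Some v"
  moreover have "prim_rec f g n (tl xs) = Some v \<Longrightarrow>
    \<forall>\<^sub>F t in sequentially. prim_rec (s t) (s' t) n (tl xs) = Some v" for n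
  proof (induction n arbitrary: v)
    case 0
    with stages_complete[OF f, of "tl xs"] len show ?case by simp
  next
    case (Suc n)
    then obtain r where r: "prim_rec f g n (tl xs) = Some r" "g (n # r # tl xs) = Some v"
      by (auto simp: bind_eq_Some_conv)
    have "\<forall>\<^sub>F t in sequentially. s' t (n # r # tl xs) = Some v"
      using stages_complete[OF g _ r(2)] len by simp
    with Suc.IH[OF r(1)] show ?case by eventually_elim simp
  qed
  ultimately show "\<forall>\<^sub>F t in sequentially. prim_rec (s t) (s' t) (hd xs) (tl xs) = Some v" by blast
qed

section \<open>Stages of unbounded search\<close>

lemma minimise_eq_Some_iff:
  "minimise f xs = Some y \<longleftrightarrow> f (y # xs) = Some 0 \<and> (\<forall>i<y. \<exists>v>0. f (i # xs) = Some v)"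
proof
  assume "minimise f xs = Some y"
  then obtain z where z: "f (z # xs) = Some 0" "\<forall>i<z. f (i # xs) \<noteq> None"
    and y: "y = (LEAST y. f (y # xs) = Some 0)"
    by (auto simp: minimise_def split: if_splits)
  have "f (y # xs) = Some 0" unfolding y using z(1) by (rule LeastI)
  \<comment> \<open>The definition gives convergence below the witness \<open>z\<close>; since the
    least zero does not exceed \<open>z\<close>, convergence below \<open>y\<close> follows.\<close>
  moreover have "y \<le> z" unfolding y using z(1) by (rule Least_le)
  moreover have "f (i # xs) \<noteq> Some 0" if "i < y" for i using that not_less_Least unfolding y by blast
  ultimately show "f (y # xs) = Some 0 \<and> (\<forall>i<y. \<exists>v>0. f (i # xs) = Some v)"
    using z(2) by (metis bot_nat_0.not_eq_extremum less_le_trans option.exhaust)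
next
  assume y: "f (y # xs) = Some 0 \<and> (\<forall>i<y. \<exists>v>0. f (i # xs) = Some v)"
  then have "(LEAST y. f (y # xs) = Some 0) = y"
    by (intro Least_equality) (auto simp: not_less[symmetric])
  moreover have "\<exists>y. f (y # xs) = Some 0 \<and> (\<forall>i<y. f (i # xs) \<noteq> None)"
    using y by (intro exI[of _ y]) auto
  ultimately show "minimise f xs = Some y" by (simp add: minimise_def)
qed

text \<open>State of the search after testing the arguments below \<open>n\<close>: 0 when \<open>f\<close> diverged, 1 while
  the search is still running, \<open>y + 2\<close> when \<open>y\<close> was found.\<close>

definition search :: "(nat list \<rightharpoonup> nat) \<Rightarrow> nat list \<Rightarrow> nat \<Rightarrow> nat" where
  "search f xs = rec_nat 1 (\<lambda>n r. if r - 1 = 0 then if r = 0 then 0 else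
     if encode_option (f (n # xs)) = 0 then 0
     else if encode_option (f (n # xs)) - 1 = 0 then Suc (Suc n) else 1 else r)"

lemma search_running: "search f xs n = 1 \<longleftrightarrow> (\<forall>i<n. \<exists>v>0. f (i # xs) = Some v)"
proof (induction n)
  case (Suc n)
  then show ?case
    by (cases "f (n # xs)") (auto simp: search_def less_Suc_eq)
qed (simp add: search_def)

text \<open>A result is either inherited from an earlier test or produced by testing
  \<open>y\<close> itself while the search is still running; by \<open>search_running\<close> the
  latter says that all smaller arguments gave positive values.\<close>

lemma search_found:
  "search f xs n = Suc (Suc y) \<longleftrightarrow> y < n \<and> minimise f xs = Some y"
proof (induction n)
  case 0
  then show ?case by (simp add: search_def)
next
  case (Suc n)
  have step: "search f xs (Suc n) = Suc (Suc y) \<longleftrightarrow>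
      search f xs n = Suc (Suc y) \<or> search f xs n = 1 \<and> n = y \<and> f (n # xs) = Some 0"
    by (cases "f (n # xs)") (auto simp: search_def split: if_splits)
  show ?case unfolding step search_running Suc.IH
    by (auto simp: minimise_eq_Some_iff less_Suc_eq)
qed

text \<open>Stage \<open>t\<close> tests the candidates below \<open>t\<close> against stage
  \<open>t\<close> of \<open>f\<close>. A successful search rests on finitely many convergent
  values, so it remains valid for \<open>f\<close>; conversely, these values are all present at
  large stages, and eventually \<open>y < t\<close>.\<close>

lemma stages_minimise:
  assumes f: "stages (Suc k) s f"
  defines "S \<equiv> \<lambda>t xs. if \<exists>y<t. minimise (s t) xs = Some y then minimise (s t) xs else None"
  shows "stages k S (minimise f)"
  unfolding stages_def
proof (intro conjI allI impI)
  let ?m = "Suc (Suc (Suc k))"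
  let ?e = "\<lambda>t n xs. encode_option (s t (n # xs))"
  \<comment> \<open>Here \<open>zs\<close> consists of the candidate, the search state, the stage
    and the \<open>k\<close> parameters.\<close>
  have "recursive_fn ?m (\<lambda>zs. ?e (zs ! 2) (zs ! 0) (drop 3 zs))"
    using stages_recursive_fn[of "[\<lambda>zs. zs ! 0]" k s f ?m "\<lambda>zs. zs ! 2" 3] f
    by (simp add: recursive_fn_nth)
  then have e: "recursive_fn ?m (\<lambda>zs. ?e (hd (drop 2 zs)) (zs ! 0) (tl (drop 2 zs)))"
    by (rule recursive_fn_cong) (auto simp: numeral_eq_Suc length_Suc_conv)
  have "recursive_fn (Suc k) (\<lambda>ys. search (s (hd ys)) (tl ys) (hd ys))"
    unfolding search_def using e recursive_fn_hd
    by (intro recursive_fn_rec_nat recursive_fn_if_zero recursive_fn_const recursive_fn_Suc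
        recursive_fn_pred recursive_fn_nth) auto
  \<comment> \<open>Subtracting 1 merges the states diverged (0) and running (1) into the code of
    \<open>None\<close>, and turns the state \<open>y + 2\<close> into the code of
    \<open>Some y\<close>.\<close>
  moreover have "search (s t) xs t - 1 = encode_option (S t xs)" for t xs
  proof (cases "\<exists>y. search (s t) xs t = Suc (Suc y)")
    case True
    then obtain y where y: "search (s t) xs t = Suc (Suc y)" by blast
    then have "S t xs = Some y" by (auto simp: search_found S_def)
    with y show ?thesis by simp
  next
    case False
    then have "search (s t) xs t - 1 = 0" by (cases "search (s t) xs t"; cases "search (s t) xs t - 1") auto
    moreover have "S t xs = None" using False by (auto simp: search_found S_def)
    ultimately show ?thesis by simp
  qed
  ultimately show "recursive_fn (Suc k) (\<lambda>ys. encode_option (S (hd ys) (tl ys)))"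
    using recursive_fn_pred[of "Suc k" "\<lambda>ys. search (s (hd ys)) (tl ys) (hd ys)"] by simp
next
  fix xs :: "nat list" and y t
  assume "length xs = k" "S t xs = Some y"
  then have "minimise (s t) xs = Some y" and sound: "\<And>i v. s t (i # xs) = Some v \<Longrightarrow> f (i # xs) = Some v"
    using stages_sound[OF f] by (auto simp: S_def split: if_splits)
  then show "minimise f xs = Some y"
    unfolding minimise_eq_Some_iff by blast
next
  fix xs :: "nat list" and y
  assume len: "length xs = k" and "minimise f xs = Some y"
  then have y: "f (y # xs) = Some 0" "\<forall>i<y. \<exists>v>0. f (i # xs) = Some v"
    by (auto simp: minimise_eq_Some_iff)
  have "\<forall>\<^sub>F t in sequentially. \<forall>i\<in>{..<y}. \<exists>v>0. s t (i # xs) = Some v"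
  proof (intro eventually_ball_finite ballI)
    fix i assume "i \<in> {..<y}"
    with y(2) obtain v where v: "v > 0" "f (i # xs) = Some v" by auto
    with stages_complete[OF f _ v(2)] len have "\<forall>\<^sub>F t in sequentially. s t (i # xs) = Some v" by simp
    then show "\<forall>\<^sub>F t in sequentially. \<exists>v>0. s t (i # xs) = Some v"
      using v(1) by (auto elim: eventually_mono)
  qed simp
  moreover have "\<forall>\<^sub>F t in sequentially. s t (y # xs) = Some 0"
    using stages_complete[OF f _ y(1)] len by simp
  moreover have "\<forall>\<^sub>F t in sequentially. y < t" by (rule eventually_gt_at_top)
  ultimately show "\<forall>\<^sub>F t in sequentially. S t xs = Some y"
  proof eventually_elim
    case (elim t)
    then have "minimise (s t) xs = Some y" by (simp add: minimise_eq_Some_iff)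
    with elim show ?case by (simp add: S_def)
  qed
qed

text \<open>This serves as a normal form theorem without coding computations as numbers. In the case
  \<open>ext\<close> the same stages work, because \<open>stages\<close> consults \<open>f\<close>
  only on lists of length \<open>k\<close>.\<close>

theorem partial_recursive_stages:
  "partial_recursive k f \<Longrightarrow> \<exists>s. stages k s f"
proof (induction rule: partial_recursive.induct)
  case (zero k)
  show ?case using stages_of_total recursive_fn_const by blast
next
  case succ
  have "recursive_fn 1 (\<lambda>xs. Suc (hd xs))"
    unfolding recursive_fn_def by (rule partial_recursive.succ)
  then show ?case using stages_of_total by blast
next
  case (proj i k)
  then show ?case using stages_of_total recursive_fn_nth by blast
next
  case (comp gs f k)
  then obtain s S where "stages (length gs) s f" "\<forall>g\<in>set gs. stages k (S g) g" by metis
  then show ?case using stages_compose by blast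
next
  case (prec k f g)
  then show ?case using stages_prim_rec by blast
next
  case (mini k f)
  then show ?case using stages_minimise by blast
next
  case (ext k f f')
  then show ?case unfolding stages_def by metis
qed


section \<open>Completeness of the sup-interpretation problem\<close>

lemma total_recursive_fn:
  assumes "total_recursive F" "i < k"
  shows "recursive_fn k (\<lambda>xs. F (xs ! i))"
  using recursive_fn_unary[of F k "\<lambda>xs. xs ! i", OF _ recursive_fn_nth[OF assms(2)]] assms(1)
  by (simp add: total_recursive_def recursive_fn_def)

lemma pi_set_one_iff:
  "pi_set 1 A \<longleftrightarrow> (\<exists>Q. decidable_rel 2 Q \<and> (\<forall>x. x \<in> A \<longleftrightarrow> (\<forall>y. Q [y, x])))"
proof
  assume "pi_set 1 A"
  then obtain Q where "decidable_rel 2 Q" "\<And>xs. length xs = 1 \<Longrightarrow> hd xs \<in> A \<longleftrightarrow> (\<forall>y. Q (y # xs))"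
    by (auto simp: pi_set_def numeral_2_eq_2)
  from this(1) this(2)[of "[_]"] show "\<exists>Q. decidable_rel 2 Q \<and> (\<forall>x. x \<in> A \<longleftrightarrow> (\<forall>y. Q [y, x]))"
    by auto
next
  assume "\<exists>Q. decidable_rel 2 Q \<and> (\<forall>x. x \<in> A \<longleftrightarrow> (\<forall>y. Q [y, x]))"
  then show "pi_set 1 A"
    by (auto simp: pi_set_def numeral_2_eq_2 length_Suc_conv)
qed

section \<open>Membership of the problem in the first universal level\<close>

lemma SI_iff: "x \<in> SI \<phi> F \<longleftrightarrow> (\<forall>z v. \<phi> x z = Some v \<longrightarrow> v \<le> F z)"
  by (auto simp: SI_def dom_def)

lemma pi_set_SI:
  assumes "partial_recursive 2 (\<lambda>xs. \<phi> (xs ! 0) (xs ! 1))" and "total_recursive F"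
  shows "pi_set 1 (SI \<phi> F)"
proof -
  obtain s where s: "stages 2 s (\<lambda>xs. \<phi> (xs ! 0) (xs ! 1))"
    using partial_recursive_stages[OF assms(1)] by blast
  \<comment> \<open>Truncated subtraction treats both cases at once: a code \<open>v + 1\<close>
    gives 0 exactly when \<open>v \<le> F z\<close>, and the code 0 of divergence always
    does.\<close>
  let ?P = "\<lambda>z ys. encode_option (s (ys ! 0) [ys ! 1, z]) - Suc (F z) = 0"
  have "recursive_fn 3 (\<lambda>ys. encode_option (s (ys ! 1) [ys ! 2, ys ! 0]))"
  proof (rule recursive_fn_cong)
    show "recursive_fn 3 (\<lambda>ys. encode_option
        (s (ys ! 1) (map (\<lambda>g. g ys) [\<lambda>ys. ys ! 2, \<lambda>ys. ys ! 0] @ drop 3 ys)))"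
    proof (rule stages_recursive_fn)
      show "stages (length [\<lambda>ys. ys ! 2, \<lambda>ys. ys ! 0] + 0) s (\<lambda>xs. \<phi> (xs ! 0) (xs ! 1))"
        using s by (simp only: list.size add_0_right numeral_2_eq_2 add_Suc_right One_nat_def)
      show "\<forall>a\<in>set [\<lambda>ys. ys ! 2, \<lambda>ys. ys ! 0]. recursive_fn 3 a"
        by (simp add: recursive_fn_nth)
    qed (simp_all add: recursive_fn_nth)
  qed simp
  moreover have "recursive_fn 3 (\<lambda>ys. F (ys ! 0))"
    using assms(2) by (rule total_recursive_fn) simp
  ultimately have "recursive_fn 3 (\<lambda>ys. if encode_option (s (ys ! 1) [ys ! 2, ys ! 0]) -
      Suc (F (ys ! 0)) = 0 then 1 else 0)"
    by (intro recursive_fn_if_zero recursive_fn_diff recursive_fn_Suc recursive_fn_const)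
  then have "recursive_fn (Suc 2) (\<lambda>ys. of_bool (?P (hd ys) (tl ys)))"
    by (simp, elim recursive_fn_cong) (auto simp: numeral_eq_Suc length_Suc_conv)
  from recursive_fn_ball_less[OF this recursive_fn_Suc[OF recursive_fn_nth[of 0]]]
  have "decidable_rel 2 (\<lambda>ys. \<forall>z < Suc (ys ! 0). ?P z ys)"
    by (simp add: decidable_rel_def recursive_fn_def)
  moreover have "x \<in> SI \<phi> F \<longleftrightarrow> (\<forall>y. \<forall>z < Suc y. ?P z [y, x])" for x
  proof
    assume x: "x \<in> SI \<phi> F"
    have "?P z [y, x]" for y z
      using stages_sound[OF s, of "[x, z]" y] x
      by (cases "s y [x, z]") (auto simp: SI_iff)
    then show "\<forall>y. \<forall>z < Suc y. ?P z [y, x]" by blast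
  next
    assume P: "\<forall>y. \<forall>z < Suc y. ?P z [y, x]"
    show "x \<in> SI \<phi> F" unfolding SI_iff
    proof (intro allI impI)
      fix z v assume v: "\<phi> x z = Some v"
      have "\<forall>\<^sub>F y in sequentially. s y [x, z] = Some v"
        using stages_complete[OF s, of "[x, z]" v] v by simp
      \<comment> \<open>One number \<open>y\<close> serves both as the stage and as the bound on the
        inputs, which is why a single unbounded quantifier suffices.\<close>
      with eventually_ge_at_top[of z] have "\<forall>\<^sub>F y in sequentially. z \<le> y \<and> s y [x, z] = Some v"
        by eventually_elim simp
      then obtain y where "z \<le> y" "s y [x, z] = Some v"
        by (auto simp: eventually_sequentially)
      with P[rule_format, of z y] show "v \<le> F z" by simp
    qed
  qed
  ultimately show ?thesis unfolding pi_set_one_iff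
    by (intro exI[of _ "\<lambda>ys. \<forall>z < Suc (ys ! 0). ?P z ys"]) simp
qed

section \<open>Hardness for the first universal level\<close>

lemma many_one_reducible_SI:
  assumes "acceptable_numbering \<phi>" and "total_recursive F" and "pi_set 1 B"
  shows "many_one_reducible B (SI \<phi> F)"
proof -
  obtain Q where Q: "decidable_rel 2 Q" and B: "\<And>x. x \<in> B \<longleftrightarrow> (\<forall>y. Q [y, x])"
    using assms(3) unfolding pi_set_one_iff by blast
  \<comment> \<open>A zero of \<open>q\<close> is a counterexample to \<open>Q\<close>, so
    minimisation searches for one; the third argument \<open>z\<close> is ignored.\<close>
  define q where "q = (\<lambda>ys. Some (of_bool (Q [ys ! 0, ys ! 1]) :: nat))"
  \<comment> \<open>The result of the search is discarded by the projection, but composition is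
    strict, so \<open>\<psi>\<close> diverges whenever the search does.\<close>
  define \<psi> where "\<psi> = compose (\<lambda>xs. Some (xs ! 1)) [minimise q, \<lambda>xs. Some (Suc (F (xs ! 1)))]"
  have "recursive_fn 3 (\<lambda>ys. of_bool (Q [ys ! 0, ys ! 1]))"
    using recursive_fn_comp[of "[\<lambda>ys. ys ! 0, \<lambda>ys. ys ! 1]" "\<lambda>xs. of_bool (Q xs)" 3] Q
      recursive_fn_nth[of 0 3] recursive_fn_nth[of 1 3]
    by (simp add: decidable_rel_def recursive_fn_def numeral_2_eq_2)
  then have "partial_recursive 2 (minimise q)"
    unfolding q_def recursive_fn_def by (intro mini) simp
  moreover have "recursive_fn 2 (\<lambda>xs. Suc (F (xs ! 1)))"
    using assms(2) by (intro recursive_fn_Suc total_recursive_fn) simp_all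
  ultimately have "partial_recursive 2 \<psi>"
    unfolding \<psi>_def recursive_fn_def by (intro comp) (auto intro: proj)
  then obtain h where h: "total_recursive h" "\<And>x z. \<phi> (h x) z = \<psi> [x, z]"
    using assms(1) unfolding acceptable_numbering_def by blast
  have \<psi>: "\<psi> [x, z] = (if x \<in> B then None else Some (Suc (F z)))" for x z
  proof -
    \<comment> \<open>As \<open>q\<close> is total, the search can fail only for lack of a
      counterexample.\<close>
    have "minimise q [x, z] = None \<longleftrightarrow> x \<in> B"
      by (simp add: minimise_def q_def B)
    then show ?thesis
      by (cases "minimise q [x, z]") (auto simp: \<psi>_def compose_def)
  qed
  have "x \<in> B \<longleftrightarrow> h x \<in> SI \<phi> F" for x
    by (simp add: SI_iff h(2) \<psi> not_less_eq_eq)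
  with h(1) show ?thesis unfolding many_one_reducible_def by blast
qed

theorem theorem4:
  fixes \<phi> :: "nat \<Rightarrow> (nat \<rightharpoonup> nat)" and F :: "nat \<Rightarrow> nat"
  assumes "acceptable_numbering \<phi>"
    and "total_recursive F"
  shows "pi_complete 1 (SI \<phi> F)"
proof -
  have "pi_set 1 (SI \<phi> F)"
    using assms unfolding acceptable_numbering_def by (intro pi_set_SI) (elim conjunct1)
  with many_one_reducible_SI[OF assms] show ?thesis
    unfolding pi_complete_def by blast
qed

end
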